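(* Let $m,n_1,\dots,n_m,k_1,\dots,k_m$ be positive integers. Let $x_1,\dots,x_m$ be pairwise coprime positive integers such that, for every $j=1,\dots,m$, $n_j$ is the smallest positive integer for which $a_j:=\bigl(x_j^{1/k_j}\bigr)^{n_j}$ is a positive integer. Then the polynomial $$q(\{n_i\},\{a_j\};z)=\chi\bigl(C_1\boxplus\dots\boxplus C_m;\,z\bigr)$$ in the variable $z$, where $C_j$ is the Frobenius companion matrix of the polynomial $t^{n_j}-a_j$, is irreducible over $\mathbb{Q}$.
   Context: $x_j^{1/k_j}$ is the positive real root. The Frobenius companion matrix of $t^{k}-a$ is the $k\times k$ matrix with $1$'s on the subdiagonal, top-right entry $a$ and all other entries $0$ (for $k=1$ it is the $1\times1$ matrix $(a)$). For square matrices $A$ of order $p$ and $B$ of order $q$, the Kronecker sum is $A\boxplus B=A\otimes I_q+I_p\otimes B$ (an associative operation). $\chi(M;z)=\det(zI-M)$. *)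

theory Defs
  imports Complex_Main "Jordan_Normal_Form.Char_Poly"
begin

(* The companion matrix of t^n - a, intended for n >= 1. For n = 1 the top-right entry is the
   only entry. *)
definition binomial_companion :: "nat \<Rightarrow> 'a \<Rightarrow> 'a::comm_ring_1 mat" where
  "binomial_companion n a =
     mat n n (\<lambda>(i, j). if i = Suc j then 1 else if i = 0 \<and> j = n - 1 then a else 0)"

definition kronecker_product :: "'a::comm_ring_1 mat \<Rightarrow> 'a mat \<Rightarrow> 'a mat" where
  "kronecker_product A B =
     mat (dim_row A * dim_row B) (dim_col A * dim_col B)
       (\<lambda>(i, j). A $$ (i div dim_row B, j div dim_col B) * B $$ (i mod dim_row B, j mod dim_col B))"

definition kronecker_sum :: "'a::comm_ring_1 mat \<Rightarrow> 'a mat \<Rightarrow> 'a mat" where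
  "kronecker_sum A B =
     kronecker_product A (1\<^sub>m (dim_row B)) + kronecker_product (1\<^sub>m (dim_row A)) B"

(* The value on the empty list is the neutral element of the Kronecker sum. *)
fun kronecker_sum_list :: "'a::comm_ring_1 mat list \<Rightarrow> 'a mat" where
  "kronecker_sum_list [] = 0\<^sub>m 1 1"
| "kronecker_sum_list [A] = A"
| "kronecker_sum_list (A # B # As) = kronecker_sum A (kronecker_sum_list (B # As))"

definition q_poly :: "nat \<Rightarrow> (nat \<Rightarrow> nat) \<Rightarrow> (nat \<Rightarrow> 'a) \<Rightarrow> 'a::comm_ring_1 poly" where
  "q_poly m n a =
     char_poly (kronecker_sum_list (map (\<lambda>j. binomial_companion (n j) (a j)) [1..<Suc m]))"

end

(* A factor g of q over Q is tested at beta = sum_j alpha_j, where alpha_j = x_j^(1/k_j). The matrix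
   M = C_1 [+] ... [+] C_m describes multiplication by beta on the N = n_1 ... n_m monomials in the
   alpha_j: their row vector w satisfies w M = beta w. These monomials have pairwise irrational
   ratios, because the x_j are coprime and the n_j minimal, and positive radicals with pairwise
   irrational ratios are linearly independent over Q (apply a trace form, which kills every irrational
   radical). If g is a nonconstant rational divisor of q = chi(M), then g(M) has a rational kernel
   vector v, and 0 = w g(M) v = g(beta) (w v) with w v nonzero, so g(beta) = 0. Hence a nontrivial
   factorization of q would make beta a multiple root. But the eigenvalues of M are the sums of
   n_j-th roots of the a_j, and beta is a simple one: every other sum has smaller real part. *)
theory Submission
  imports Defs "Jordan_Normal_Form.Schur_Decomposition" "HOL-Computational_Algebra.Nth_Powers"
begin

section \<open>Kronecker products and sums: entries, products and similarity\<close>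

text \<open>Writing \<open>k = a * q + b\<close> is the bijection behind the Kronecker indexing; for
  \<open>q = 0\<close> both sides vanish.\<close>

lemma sum_div_mod:
  fixes f :: "nat \<Rightarrow> nat \<Rightarrow> 'a::comm_monoid_add"
  shows "(\<Sum>k<p * q. f (k div q) (k mod q)) = (\<Sum>a<p. \<Sum>b<q. f a b)"
proof -
  have "(\<Sum>a<p. \<Sum>b<q. f a b) = (\<Sum>z\<in>{..<p} \<times> {..<q}. f (fst z) (snd z))"
    by (simp add: sum.cartesian_product case_prod_beta)
  also have "\<dots> = (\<Sum>k<p * q. f (k div q) (k mod q))"
  proof (rule sum.reindex_bij_witness[where i = "\<lambda>k. (k div q, k mod q)"
        and j = "\<lambda>z. fst z * q + snd z"], goal_cases)
    case (2 z)
    then have "fst z < p" "snd z < q" by auto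
    then have "fst z * q + snd z < Suc (fst z) * q" "Suc (fst z) * q \<le> p * q"
      by (simp, intro mult_right_mono, auto)
    then show ?case by auto
  next
    case (4 k)
    then show ?case
      by (cases "q = 0") (auto simp: less_mult_imp_div_less)
  qed auto
  finally show ?thesis ..
qed

lemma div_mod_less:
  assumes "(i::nat) < p * q"
  shows "i div q < p" "i mod q < q"
  using assms by (auto simp: less_mult_imp_div_less intro!: mod_less_divisor gr0I)

lemma kronecker_product_carrier:
  assumes "A \<in> carrier_mat p p" "B \<in> carrier_mat q q"
  shows "kronecker_product A B \<in> carrier_mat (p * q) (p * q)"
  using assms by (auto simp: kronecker_product_def)

lemma kronecker_product_index:
  assumes "A \<in> carrier_mat p p" "B \<in> carrier_mat q q" "i < p * q" "j < p * q"
  shows "kronecker_product A B $$ (i, j)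
    = A $$ (i div q, j div q) * B $$ (i mod q, j mod q)"
  using assms by (auto simp: kronecker_product_def)

lemma kronecker_sum_carrier:
  assumes "A \<in> carrier_mat p p" "B \<in> carrier_mat q q"
  shows "kronecker_sum A B \<in> carrier_mat (p * q) (p * q)"
  unfolding kronecker_sum_def
  using assms by (auto intro!: add_carrier_mat kronecker_product_carrier)

lemma kronecker_sum_index:
  assumes A: "A \<in> carrier_mat p p" and B: "B \<in> carrier_mat q q" and ij: "i < p * q" "j < p * q"
  shows "kronecker_sum A B $$ (i, j)
    = A $$ (i div q, j div q) * (if i mod q = j mod q then 1 else 0)
      + (if i div q = j div q then 1 else 0) * B $$ (i mod q, j mod q)"
proof -
  have *: "dim_row A = p" "dim_row B = q" using A B by auto
  have "kronecker_product (1\<^sub>m p) B \<in> carrier_mat (p * q) (p * q)"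
    by (rule kronecker_product_carrier[OF _ B]) auto
  then show ?thesis
    unfolding kronecker_sum_def * using ij
    by (simp add: kronecker_product_index[OF A one_carrier_mat] div_mod_less
        kronecker_product_index[OF one_carrier_mat B])
qed

text \<open>The mixed-product rule: a sum over Kronecker indices is a double sum, whose summand
  separates into an \<open>A\<close>-\<open>C\<close> factor and a \<open>B\<close>-\<open>D\<close>
  factor.\<close>

lemma kronecker_product_mult:
  assumes "A \<in> carrier_mat p p" "B \<in> carrier_mat q q"
    and "C \<in> carrier_mat p p" "D \<in> carrier_mat q q"
  shows "kronecker_product A B * kronecker_product C D = kronecker_product (A * C) (B * D)"
proof (rule eq_matI)
  have AC: "A * C \<in> carrier_mat p p" and BD: "B * D \<in> carrier_mat q q" using assms by auto
  note c = kronecker_product_carrier[OF assms(1,2)] kronecker_product_carrier[OF assms(3,4)]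
    kronecker_product_carrier[OF AC BD]
  show "dim_row (kronecker_product A B * kronecker_product C D)
      = dim_row (kronecker_product (A * C) (B * D))"
    "dim_col (kronecker_product A B * kronecker_product C D)
      = dim_col (kronecker_product (A * C) (B * D))"
    using c by auto
  fix i j
  assume "i < dim_row (kronecker_product (A * C) (B * D))"
    and "j < dim_col (kronecker_product (A * C) (B * D))"
  with c have ij: "i < p * q" "j < p * q" by auto
  have "(kronecker_product A B * kronecker_product C D) $$ (i, j)
      = (\<Sum>k<p * q. (A $$ (i div q, k div q) * B $$ (i mod q, k mod q))
            * (C $$ (k div q, j div q) * D $$ (k mod q, j mod q)))"
    using ij c by (simp add: scalar_prod_def atLeast0LessThan
        kronecker_product_index[OF assms(1,2)] kronecker_product_index[OF assms(3,4)])
  also have "\<dots> = (\<Sum>a<p. \<Sum>b<q. (A $$ (i div q, a) * C $$ (a, j div q))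
            * (B $$ (i mod q, b) * D $$ (b, j mod q)))"
    by (subst sum_div_mod) (simp add: mult_ac)
  also have "\<dots> = (A * C) $$ (i div q, j div q) * (B * D) $$ (i mod q, j mod q)"
    using assms div_mod_less[OF ij(1)] div_mod_less[OF ij(2)]
    by (simp add: scalar_prod_def atLeast0LessThan sum_product)
  also have "\<dots> = kronecker_product (A * C) (B * D) $$ (i, j)"
    by (simp add: kronecker_product_index[OF AC BD ij])
  finally show "(kronecker_product A B * kronecker_product C D) $$ (i, j)
    = kronecker_product (A * C) (B * D) $$ (i, j)" .
qed

lemma kronecker_product_one:
  "kronecker_product (1\<^sub>m p) (1\<^sub>m q) = (1\<^sub>m (p * q) :: 'a::comm_ring_1 mat)"
proof (rule eq_matI)
  fix i j
  assume "i < dim_row (1\<^sub>m (p * q) :: 'a mat)" "j < dim_col (1\<^sub>m (p * q) :: 'a mat)"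
  then have ij: "i < p * q" "j < p * q" by auto
  have "i = j" if "i div q = j div q" "i mod q = j mod q"
    using that by (metis div_mult_mod_eq)
  then show "kronecker_product (1\<^sub>m p) (1\<^sub>m q) $$ (i, j) = (1\<^sub>m (p * q) :: 'a mat) $$ (i, j)"
    using ij by (subst kronecker_product_index) (auto simp: div_mod_less)
qed (auto simp: kronecker_product_def)

text \<open>If \<open>P\<close> conjugates \<open>S\<close> to \<open>A\<close> and \<open>Q\<close>
  conjugates \<open>T\<close> to \<open>B\<close>, then \<open>kronecker_product P Q\<close>
  conjugates both summands of the Kronecker sum at once: by the mixed-product rule it acts on each
  tensor factor separately and fixes the identities.\<close>

lemma kronecker_sum_similar:
  assumes "A \<in> carrier_mat p p" "B \<in> carrier_mat q q"
    and "similar_mat A S" "similar_mat B T"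
  shows "similar_mat (kronecker_sum A B) (kronecker_sum S T)"
proof -
  obtain P P' where "similar_mat_wit A S P P'" using assms(3) unfolding similar_mat_def by blast
  note P = similar_mat_witD2[OF assms(1) this]
  obtain Q Q' where "similar_mat_wit B T Q Q'" using assms(4) unfolding similar_mat_def by blast
  note Q = similar_mat_witD2[OF assms(2) this]
  let ?K = "kronecker_product"
  have dims: "dim_row A = p" "dim_row B = q" "dim_row S = p" "dim_row T = q"
    using P Q by auto
  note c = kronecker_product_carrier[OF P(6) Q(6)] kronecker_product_carrier[OF P(7) Q(7)]
    kronecker_product_carrier[OF P(5) one_carrier_mat[of q]]
    kronecker_product_carrier[OF one_carrier_mat[of p] Q(5)]
  have "?K P Q * (?K S (1\<^sub>m q) + ?K (1\<^sub>m p) T) * ?K P' Q'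
      = ?K P Q * ?K S (1\<^sub>m q) * ?K P' Q' + ?K P Q * ?K (1\<^sub>m p) T * ?K P' Q'"
    using c by (simp add: mult_add_distrib_mat[OF c(1) c(3) c(4)]
        add_mult_distrib_mat[OF mult_carrier_mat[OF c(1) c(3)] mult_carrier_mat[OF c(1) c(4)] c(2)])
  also have "?K P Q * ?K S (1\<^sub>m q) * ?K P' Q' = ?K A (1\<^sub>m q)"
    using P Q by (simp add: kronecker_product_mult[where p = p and q = q])
  also have "?K P Q * ?K (1\<^sub>m p) T * ?K P' Q' = ?K (1\<^sub>m p) B"
    using P Q by (simp add: kronecker_product_mult[where p = p and q = q])
  finally have eq: "kronecker_sum A B = ?K P Q * kronecker_sum S T * ?K P' Q'"
    unfolding kronecker_sum_def dims by simp
  show ?thesis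
    by (rule similar_matI[OF _ _ _ eq, of "p * q"])
      (use c kronecker_sum_carrier[OF assms(1,2)] kronecker_sum_carrier[OF P(5) Q(5)] P Q in
        \<open>auto simp: kronecker_product_mult[where p = p and q = q] kronecker_product_one\<close>)
qed

section \<open>Simple eigenvalues with strictly largest real part\<close>

text \<open>The diagonal of a triangular form lists the eigenvalues with multiplicity, so the single
  index \<open>k\<close> expresses that \<beta> is a simple eigenvalue. Real parts are compared
  because they add up under Kronecker sums; moduli could not separate the eigenvalues of one
  companion matrix, which all lie on a circle.\<close>

definition simple_dominant :: "complex mat \<Rightarrow> real \<Rightarrow> bool" where
  "simple_dominant A \<beta> \<longleftrightarrow> (\<exists>n T k. A \<in> carrier_mat n n \<and> T \<in> carrier_mat n n \<and>
     similar_mat A T \<and> upper_triangular T \<and> k < n \<and> T $$ (k, k) = of_real \<beta> \<and>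
     (\<forall>i<n. i \<noteq> k \<longrightarrow> Re (T $$ (i, i)) < \<beta>))"

text \<open>The index \<open>i\<close> stands for the pair \<open>(i div q, i mod q)\<close>, and
  \<open><\<close> is the lexicographic order on pairs. Hence the Kronecker sum of triangular forms
  is again triangular. Its diagonal consists of the sums of diagonal entries, and the real part
  \<beta> + \<gamma> is reached only at the pair \<open>(k, l)\<close>.\<close>

lemma simple_dominant_kronecker_sum:
  assumes "simple_dominant A \<beta>" "simple_dominant B \<gamma>"
  shows "simple_dominant (kronecker_sum A B) (\<beta> + \<gamma>)"
proof -
  obtain p S k where A: "A \<in> carrier_mat p p" "S \<in> carrier_mat p p" "similar_mat A S"
    "upper_triangular S" "k < p" "S $$ (k, k) = of_real \<beta>"
    "\<And>i. i < p \<Longrightarrow> i \<noteq> k \<Longrightarrow> Re (S $$ (i, i)) < \<beta>"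
    using assms(1) unfolding simple_dominant_def by blast
  obtain q T l where B: "B \<in> carrier_mat q q" "T \<in> carrier_mat q q" "similar_mat B T"
    "upper_triangular T" "l < q" "T $$ (l, l) = of_real \<gamma>"
    "\<And>i. i < q \<Longrightarrow> i \<noteq> l \<Longrightarrow> Re (T $$ (i, i)) < \<gamma>"
    using assms(2) unfolding simple_dominant_def by blast
  have "k * q + l < Suc k * q" "Suc k * q \<le> p * q"
    using A(5) B(5) by (simp, intro mult_right_mono, auto)
  then have m: "k * q + l < p * q" by linarith
  note idx = kronecker_sum_index[OF A(2) B(2)]
  have ut: "upper_triangular (kronecker_sum S T)"
  proof (rule upper_triangularI)
    fix i j
    assume "j < i" "i < dim_row (kronecker_sum S T)"
    then have ij: "i < p * q" "j < p * q" "j < i" using kronecker_sum_carrier[OF A(2) B(2)] by auto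
    then have "j div q \<le> i div q" by (intro div_le_mono) simp
    moreover have "j mod q < i mod q" if "j div q = i div q"
      using that ij(3) by (metis div_mult_mod_eq nat_add_left_cancel_less)
    ultimately consider "j div q < i div q" "i mod q = j mod q"
      | "j div q < i div q" "i mod q \<noteq> j mod q" | "j div q = i div q" "j mod q < i mod q"
      by fastforce
    then show "kronecker_sum S T $$ (i, j) = 0"
      using A(2,4) B(2,4) div_mod_less[OF ij(1)]
      by cases (auto simp: idx[OF ij(1,2)] upper_triangular_def)
  qed
  have "Re (kronecker_sum S T $$ (i, i)) < \<beta> + \<gamma>" if i: "i < p * q" "i \<noteq> k * q + l" for i
  proof -
    have "i div q \<noteq> k \<or> i mod q \<noteq> l" using i(2) by (metis div_mult_mod_eq)
    moreover have "Re (S $$ (i div q, i div q)) \<le> \<beta>"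
      using A(6) A(7)[of "i div q"] div_mod_less[OF i(1)]
      by (cases "i div q = k") (auto intro: less_imp_le)
    moreover have "Re (T $$ (i mod q, i mod q)) \<le> \<gamma>"
      using B(6) B(7)[of "i mod q"] div_mod_less[OF i(1)]
      by (cases "i mod q = l") (auto intro: less_imp_le)
    ultimately show ?thesis
      using A(7)[of "i div q"] B(7)[of "i mod q"] div_mod_less[OF i(1)]
      by (force simp: idx[OF i(1) i(1)])
  qed
  moreover have "kronecker_sum S T $$ (k * q + l, k * q + l) = of_real (\<beta> + \<gamma>)"
    using A(6) B(5,6) by (simp add: idx[OF m m])
  ultimately show ?thesis
    unfolding simple_dominant_def
    using kronecker_sum_carrier[OF A(1) B(1)] kronecker_sum_carrier[OF A(2) B(2)]
      kronecker_sum_similar[OF A(1) B(1) A(3) B(3)] ut m by blast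
qed

text \<open>The characteristic polynomial is read off the triangular form; the factors other than
  the one at \<open>k\<close> have roots of smaller real part, so their product does not vanish at
  \<beta>.\<close>

lemma simple_dominant_char_poly:
  assumes "simple_dominant A \<beta>"
  shows "\<exists>h. char_poly A = [:- of_real \<beta>, 1:] * h \<and> poly h (of_real \<beta>) \<noteq> 0"
proof -
  obtain n T k where A: "A \<in> carrier_mat n n" "T \<in> carrier_mat n n" "similar_mat A T"
    "upper_triangular T" "k < n" "T $$ (k, k) = of_real \<beta>"
    "\<And>i. i < n \<Longrightarrow> i \<noteq> k \<Longrightarrow> Re (T $$ (i, i)) < \<beta>"
    using assms unfolding simple_dominant_def by blast
  have "char_poly A = (\<Prod>a\<leftarrow>diag_mat T. [:- a, 1:])"
    using char_poly_similar[OF A(3)] char_poly_upper_triangular[OF A(2,4)] by simp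
  also have "\<dots> = (\<Prod>i<n. [:- T $$ (i, i), 1:])"
    using A(2) by (simp add: diag_mat_def prod.list_conv_set_nth atLeast0LessThan)
  also have "\<dots> = [:- of_real \<beta>, 1:] * (\<Prod>i\<in>{..<n} - {k}. [:- T $$ (i, i), 1:])"
    using A(5,6) by (subst prod.remove[of _ k]) auto
  finally have "char_poly A = [:- of_real \<beta>, 1:] * (\<Prod>i\<in>{..<n} - {k}. [:- T $$ (i, i), 1:])" .
  moreover have "poly (\<Prod>i\<in>{..<n} - {k}. [:- T $$ (i, i), 1:]) (of_real \<beta>) \<noteq> 0"
  proof -
    have "T $$ (i, i) \<noteq> of_real \<beta>" if "i < n" "i \<noteq> k" for i
      using A(7)[OF that] by auto
    then show ?thesis by (auto simp: poly_prod, metis)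
  qed
  ultimately show ?thesis by blast
qed

section \<open>Left eigenvectors independent over the rationals, and rational factors\<close>

interpretation of_rat_poly_hom: map_poly_inj_idom_hom of_rat ..

abbreviation rpoly :: "rat poly \<Rightarrow> real \<Rightarrow> real" where
  "rpoly p \<equiv> poly (map_poly of_rat p)"

lemma rpoly_simps:
  "rpoly (p * q) x = rpoly p x * rpoly q x"
  "rpoly (p + q) x = rpoly p x + rpoly q x"
  by (simp_all add: of_rat_poly_hom.hom_mult of_rat_poly_hom.hom_add)

definition rat_indep :: "nat \<Rightarrow> (nat \<Rightarrow> real) \<Rightarrow> bool" where
  "rat_indep N w \<longleftrightarrow> (\<forall>c. (\<Sum>i<N. w i * of_rat (c i)) = 0 \<longrightarrow> (\<forall>i<N. c i = 0))"

text \<open>The row vector equation \<open>w M = \<beta> w\<close>, written entrywise because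
  \<open>M\<close> is rational while \<open>w\<close> and \<beta> are real. Column \<open>j\<close>
  expands \<beta> times \<open>w j\<close> in the entries of \<open>w\<close>, so \<open>M\<close>
  describes multiplication by \<beta> on their rational span.\<close>

definition left_eigen :: "nat \<Rightarrow> (nat \<Rightarrow> real) \<Rightarrow> rat mat \<Rightarrow> real \<Rightarrow> bool" where
  "left_eigen N w M \<beta> \<longleftrightarrow> M \<in> carrier_mat N N \<and>
     (\<forall>j<N. (\<Sum>i<N. w i * of_rat (M $$ (i, j))) = \<beta> * w j)"

lemma left_eigen_pow:
  assumes "left_eigen N w M \<beta>"
  shows "left_eigen N w (M ^\<^sub>m k) (\<beta> ^ k)"
proof (induction k)
  case 0
  have "(\<Sum>i<N. w i * of_rat (if i = j then 1 else 0)) = w j" if "j < N" for j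
    using that by (simp add: if_distrib[of of_rat] if_distrib[of "(*) _"] cong: if_cong)
  then show ?case using assms unfolding left_eigen_def by auto
next
  case (Suc k)
  have M: "M \<in> carrier_mat N N" using assms unfolding left_eigen_def by simp
  have Mk: "M ^\<^sub>m k \<in> carrier_mat N N" using M by simp
  have "(\<Sum>i<N. w i * of_rat ((M ^\<^sub>m k * M) $$ (i, j))) = \<beta> ^ Suc k * w j" if j: "j < N" for j
  proof -
    have "(\<Sum>i<N. w i * of_rat ((M ^\<^sub>m k * M) $$ (i, j)))
        = (\<Sum>i<N. \<Sum>l<N. w i * of_rat ((M ^\<^sub>m k) $$ (i, l)) * of_rat (M $$ (l, j)))"
      using j M Mk
      by (simp add: scalar_prod_def atLeast0LessThan of_rat_sum of_rat_mult sum_distrib_left mult.assoc)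
    also have "\<dots> = (\<Sum>l<N. (\<Sum>i<N. w i * of_rat ((M ^\<^sub>m k) $$ (i, l))) * of_rat (M $$ (l, j)))"
      by (subst sum.swap) (simp add: sum_distrib_right)
    also have "\<dots> = (\<Sum>l<N. \<beta> ^ k * (w l * of_rat (M $$ (l, j))))"
      using Suc.IH unfolding left_eigen_def by (simp add: mult_ac)
    also have "\<dots> = \<beta> ^ k * (\<beta> * w j)"
      using assms j unfolding left_eigen_def by (simp flip: sum_distrib_left)
    finally show ?thesis by (simp add: mult_ac)
  qed
  then show ?case using M mult_carrier_mat[OF Mk M] unfolding left_eigen_def by auto
qed

definition poly_mat :: "nat \<Rightarrow> 'a::comm_ring_1 poly \<Rightarrow> 'a mat \<Rightarrow> 'a mat" where
  "poly_mat N g M = mat N N (\<lambda>(i, j). \<Sum>k\<le>degree g. coeff g k * (M ^\<^sub>m k) $$ (i, j))"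

lemma poly_mat_carrier [simp]: "poly_mat N g M \<in> carrier_mat N N"
  by (simp add: poly_mat_def)

lemma left_eigen_poly_mat:
  assumes "left_eigen N w M \<beta>"
  shows "left_eigen N w (poly_mat N g M) (rpoly g \<beta>)"
proof -
  have "(\<Sum>i<N. w i * of_rat (poly_mat N g M $$ (i, j))) = rpoly g \<beta> * w j" if j: "j < N" for j
  proof -
    have "(\<Sum>i<N. w i * of_rat (poly_mat N g M $$ (i, j)))
        = (\<Sum>i<N. \<Sum>k\<le>degree g. of_rat (coeff g k) * (w i * of_rat ((M ^\<^sub>m k) $$ (i, j))))"
      using j by (simp add: poly_mat_def of_rat_sum of_rat_mult sum_distrib_left mult_ac)
    also have "\<dots> = (\<Sum>k\<le>degree g. of_rat (coeff g k) * (\<Sum>i<N. w i * of_rat ((M ^\<^sub>m k) $$ (i, j))))"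
      by (subst sum.swap) (simp add: sum_distrib_left)
    also have "\<dots> = (\<Sum>k\<le>degree g. of_rat (coeff g k) * (\<beta> ^ k * w j))"
      using left_eigen_pow[OF assms] j unfolding left_eigen_def by simp
    also have "\<dots> = rpoly g \<beta> * w j"
      by (simp add: poly_altdef sum_distrib_right mult.assoc)
    finally show ?thesis .
  qed
  then show ?thesis unfolding left_eigen_def by simp
qed

lemma eigenvector_pow_index:
  fixes A :: "'a::field mat"
  assumes "A \<in> carrier_mat N N" "eigenvector A v e" "i < N"
  shows "(\<Sum>j<N. (A ^\<^sub>m k) $$ (i, j) * v $ j) = e ^ k * v $ i"
proof -
  have v: "v \<in> carrier_vec N" using assms unfolding eigenvector_def by auto
  have "((A ^\<^sub>m k) *\<^sub>v v) $ i = e ^ k * v $ i"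
    using eigenvector_pow[OF assms(1,2), of k] v assms(3) by simp
  then show ?thesis
    using assms v by (simp add: scalar_prod_def atLeast0LessThan mult_mat_vec_def)
qed

text \<open>A complex root of \<open>g\<close> is an eigenvalue of \<open>M\<close>, and
  \<open>g(M)\<close> kills its eigenvector. Hence \<open>g(M)\<close> has determinant 0; as this
  determinant is rational, there is a kernel vector over the rationals too.\<close>

lemma poly_mat_singular:
  fixes M :: "rat mat"
  assumes M: "M \<in> carrier_mat N N" and g: "g dvd char_poly M" "degree g > 0"
  shows "\<exists>v. v \<in> carrier_vec N \<and> v \<noteq> 0\<^sub>v N \<and> poly_mat N g M *\<^sub>v v = 0\<^sub>v N"
proof -
  let ?h = "of_rat :: rat \<Rightarrow> complex"
  let ?A = "map_mat ?h M" and ?g = "map_poly ?h g"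
  have A: "?A \<in> carrier_mat N N" using M by simp
  have "\<not> constant (poly ?g)"
    using g(2) by (simp add: constant_degree)
  then obtain e where e: "poly ?g e = 0" using fundamental_theorem_of_algebra by blast
  have "?g dvd char_poly ?A"
    using g(1) unfolding of_rat_hom.char_poly_hom[OF M]
    by (auto simp: dvd_def of_rat_poly_hom.hom_mult)
  then have "eigenvalue ?A e"
    using e unfolding eigenvalue_root_char_poly[OF A] by (auto simp: dvd_def)
  then obtain u where u: "eigenvector ?A u e" unfolding eigenvalue_def by blast
  then have uc: "u \<in> carrier_vec N" "u \<noteq> 0\<^sub>v N" using A unfolding eigenvector_def by auto
  have "(map_mat ?h (poly_mat N g M) *\<^sub>v u) $ i = 0" if i: "i < N" for i
  proof -
    have pw: "?h ((M ^\<^sub>m k) $$ (i, j)) = (?A ^\<^sub>m k) $$ (i, j)" if "j < N" for j k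
      using that i M by (simp flip: of_rat_hom.mat_hom_pow[OF M])
    have "(map_mat ?h (poly_mat N g M) *\<^sub>v u) $ i
        = (\<Sum>j<N. \<Sum>k\<le>degree g. ?h (coeff g k) * ((?A ^\<^sub>m k) $$ (i, j) * u $ j))"
      using i uc pw
      by (simp add: scalar_prod_def atLeast0LessThan poly_mat_def of_rat_sum of_rat_mult
          sum_distrib_right mult.assoc)
    also have "\<dots> = (\<Sum>k\<le>degree g. ?h (coeff g k) * (e ^ k * u $ i))"
      by (subst sum.swap) (simp add: eigenvector_pow_index[OF A u i] flip: sum_distrib_left)
    also have "\<dots> = poly ?g e * u $ i"
      by (simp add: poly_altdef sum_distrib_right mult.assoc)
    finally show ?thesis using e by simp
  qed
  then have "map_mat ?h (poly_mat N g M) *\<^sub>v u = 0\<^sub>v N"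
    by (intro eq_vecI) (auto simp: carrier_matD[OF poly_mat_carrier])
  then have "det (map_mat ?h (poly_mat N g M)) = 0"
    using uc by (subst det_0_iff_vec_prod_zero_field[of _ N]) auto
  then have "det (poly_mat N g M) = 0" by simp
  then show ?thesis
    by (subst (asm) det_0_iff_vec_prod_zero_field[of _ N]) auto
qed

text \<open>A rational kernel vector of \<open>g(M)\<close> pairs to something nonzero with \<open>w\<close>, while
  \<open>w g(M) = g(\<beta>) w\<close>.\<close>

lemma rpoly_factor_char_poly_eq_0:
  assumes w: "rat_indep N w" "left_eigen N w M \<beta>"
    and g: "g dvd char_poly M" "degree g > 0"
  shows "rpoly g \<beta> = 0"
proof -
  have M: "M \<in> carrier_mat N N" using w unfolding left_eigen_def by simp
  obtain v where v: "v \<in> carrier_vec N" "v \<noteq> 0\<^sub>v N" "poly_mat N g M *\<^sub>v v = 0\<^sub>v N"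
    using poly_mat_singular[OF M g] by blast
  let ?G = "poly_mat N g M"
  have G: "(\<Sum>j<N. ?G $$ (i, j) * v $ j) = 0" if "i < N" for i
  proof -
    have "(?G *\<^sub>v v) $ i = 0" using v(3) that by simp
    then show ?thesis using that v(1) poly_mat_carrier[of N g M]
      by (simp add: scalar_prod_def atLeast0LessThan carrier_matD del: poly_mat_carrier)
  qed
  have "rpoly g \<beta> * (\<Sum>j<N. w j * of_rat (v $ j))
      = (\<Sum>j<N. (\<Sum>i<N. w i * of_rat (?G $$ (i, j))) * of_rat (v $ j))"
    using left_eigen_poly_mat[OF w(2), of g] unfolding left_eigen_def
    by (simp add: sum_distrib_left mult_ac)
  also have "\<dots> = (\<Sum>i<N. \<Sum>j<N. w i * of_rat (?G $$ (i, j) * v $ j))"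
    by (subst sum.swap) (simp add: sum_distrib_right of_rat_mult mult.assoc)
  also have "\<dots> = (\<Sum>i<N. w i * of_rat (\<Sum>j<N. ?G $$ (i, j) * v $ j))"
    by (simp add: of_rat_sum sum_distrib_left)
  also have "\<dots> = 0" using G by simp
  finally have "rpoly g \<beta> = 0 \<or> (\<Sum>j<N. w j * of_rat (v $ j)) = 0" by simp
  moreover have "(\<Sum>j<N. w j * of_rat (v $ j)) \<noteq> 0"
    using w(1) v(1,2) unfolding rat_indep_def by (metis eq_vecI carrier_vecD index_zero_vec)
  ultimately show ?thesis by blast
qed

lemma of_real_of_rat: "complex_of_real (of_rat q) = of_rat q"
  by (cases q) (simp add: of_rat_rat)

text \<open>Two nonconstant rational factors would both vanish at \<beta>, making it a double root
  of the characteristic polynomial, whereas \<open>h\<close> records that it is simple.\<close>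

lemma irreducible_char_poly:
  assumes w: "rat_indep N w" "left_eigen N w M \<beta>" and N: "N > 0"
    and h: "char_poly (map_mat of_rat M) = [:- complex_of_real \<beta>, 1:] * h"
      "poly h (of_real \<beta>) \<noteq> 0"
  shows "irreducible (char_poly M)"
proof (rule irreducibleI)
  have M: "M \<in> carrier_mat N N" using w unfolding left_eigen_def by simp
  note deg = degree_monic_char_poly[OF M]
  show "char_poly M \<noteq> 0" using deg by auto
  show "\<not> char_poly M dvd 1" using deg N by (auto simp: is_unit_iff_degree)
  fix f g assume fg: "char_poly M = f * g"
  show "f dvd 1 \<or> g dvd 1"
  proof (rule ccontr)
    assume "\<not> (f dvd 1 \<or> g dvd 1)"
    moreover have "f \<noteq> 0" "g \<noteq> 0" using fg deg by auto
    ultimately have pos: "degree f > 0" "degree g > 0" by (auto simp: is_unit_iff_degree)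
    have root: "poly (map_poly of_rat p) (complex_of_real \<beta>) = 0"
      if "p dvd char_poly M" "degree p > 0" for p
    proof -
      have "poly (map_poly of_rat p) (complex_of_real \<beta>) = of_real (rpoly p \<beta>)"
        by (simp add: poly_altdef of_real_of_rat)
      then show ?thesis using rpoly_factor_char_poly_eq_0[OF w that] by simp
    qed
    obtain f' g' where f': "map_poly of_rat f = [:- complex_of_real \<beta>, 1:] * f'"
      and g': "map_poly of_rat g = [:- complex_of_real \<beta>, 1:] * g'"
      using root[of f] root[of g] pos fg by (auto simp: poly_eq_0_iff_dvd dvd_def)
    have "[:- complex_of_real \<beta>, 1:] * h = map_poly of_rat f * map_poly of_rat g"
      using h(1) unfolding of_rat_hom.char_poly_hom[OF M] fg
      by (simp add: of_rat_poly_hom.hom_mult)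
    also have "\<dots> = [:- complex_of_real \<beta>, 1:] * ([:- complex_of_real \<beta>, 1:] * f' * g')"
      unfolding f' g' by (simp only: mult_ac)
    finally have "h = [:- complex_of_real \<beta>, 1:] * f' * g'"
      by (subst (asm) mult_cancel_left) auto
    then show False using h(2) by simp
  qed
qed

section \<open>The trace as a coefficient of the characteristic polynomial\<close>

definition mat_trace :: "'a::comm_ring_1 mat \<Rightarrow> 'a" where
  "mat_trace A = (\<Sum>i<dim_row A. A $$ (i, i))"

lemma mat_trace_mult_commute:
  assumes "A \<in> carrier_mat n n" "B \<in> carrier_mat n n"
  shows "mat_trace (A * B) = mat_trace (B * A)"
proof -
  have "mat_trace (A * B) = (\<Sum>i<n. \<Sum>j<n. A $$ (i, j) * B $$ (j, i))"
    using assms by (simp add: mat_trace_def scalar_prod_def atLeast0LessThan)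
  also have "\<dots> = (\<Sum>j<n. \<Sum>i<n. B $$ (j, i) * A $$ (i, j))"
    by (subst sum.swap) (simp add: mult.commute)
  also have "\<dots> = mat_trace (B * A)"
    using assms by (simp add: mat_trace_def scalar_prod_def atLeast0LessThan)
  finally show ?thesis .
qed

lemma mat_trace_similar:
  assumes A: "A \<in> carrier_mat n n" and sim: "similar_mat A B"
  shows "mat_trace A = mat_trace B"
proof -
  obtain P Q where "similar_mat_wit A B P Q" using sim unfolding similar_mat_def by blast
  note w = similar_mat_witD2[OF A this]
  have "mat_trace A = mat_trace (P * (B * Q))" using w by (simp add: assoc_mult_mat[of _ n n _ n _ n])
  also have "\<dots> = mat_trace (B * Q * P)" using w by (intro mat_trace_mult_commute) auto
  also have "B * Q * P = B" using w by (simp add: assoc_mult_mat[of _ n n _ n _ n])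
  finally show ?thesis .
qed

text \<open>One joint induction: on passing to \<open>a # as\<close>, the leading coefficient uses
  the vanishing above it, and the second coefficient uses the leading one.\<close>

lemma prod_linear_coeffs:
  fixes as :: "'a::comm_ring_1 list"
  defines "p \<equiv> \<lambda>as :: 'a list. \<Prod>a\<leftarrow>as. [:- a, 1:]"
  shows "coeff (p as) (length as) = 1" "k > length as \<Longrightarrow> coeff (p as) k = 0"
    "length as = Suc n \<Longrightarrow> coeff (p as) n = - sum_list as"
proof (induction as arbitrary: n k)
  case (Cons a as)
  have p: "p (a # as) = [:- a, 1:] * p as" by (simp add: p_def)
  { case 1 show ?case using Cons.IH(1,2) by (simp add: p coeff_pCons) }
  { case 2 then show ?case using Cons.IH(2) by (auto simp: p coeff_pCons split: nat.split) }
  { case 3 then show ?case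
      using Cons.IH(1,3) by (cases "length as") (auto simp: p coeff_pCons p_def) }
qed (auto simp: p_def coeff_eq_0)

text \<open>Over the complex numbers the Schur form has the eigenvalues on its diagonal, and
  similarity preserves the trace. The resulting identity is between rational numbers, so it
  descends.\<close>

lemma coeff_char_poly_mat_trace:
  fixes M :: "rat mat"
  assumes M: "M \<in> carrier_mat (Suc n) (Suc n)"
  shows "coeff (char_poly M) n = - mat_trace M"
proof -
  let ?A = "map_mat of_rat M :: complex mat"
  have A: "?A \<in> carrier_mat (Suc n) (Suc n)" using M by simp
  obtain as where as: "char_poly ?A = (\<Prod>a\<leftarrow>as. [:- a, 1:])" "length as = Suc n"
    using char_poly_factorized[OF A] by blast
  obtain B P Q where B: "schur_decomposition ?A as = (B, P, Q)"
    by (cases "schur_decomposition ?A as")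
  have wit: "similar_mat_wit ?A B P Q" and diag: "diag_mat B = as"
    using schur_decomposition[OF A as(1) B] by auto
  have "coeff (char_poly ?A) n = - sum_list as"
    unfolding as(1) by (rule prod_linear_coeffs(3)[OF as(2)])
  also have "sum_list as = mat_trace B"
    unfolding diag[symmetric] diag_mat_def mat_trace_def
    by (simp add: sum_list_sum_nth atLeast0LessThan)
  also have "mat_trace B = mat_trace ?A"
    using mat_trace_similar[OF A] wit unfolding similar_mat_def by metis
  also have "mat_trace ?A = of_rat (mat_trace M)"
    using M by (simp add: mat_trace_def of_rat_sum of_rat_add)
  finally have "of_rat (coeff (char_poly M) n) = (of_rat (- mat_trace M) :: complex)"
    by (simp add: of_rat_hom.char_poly_hom[OF M] of_rat_minus)
  then show ?thesis by (simp only: of_rat_eq_iff)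
qed

section \<open>Minimal polynomials of real radicals and their traces\<close>

lemma degree_monom_minus_const:
  fixes c :: "'a::comm_ring_1"
  assumes "e > 0"
  shows "degree (monom 1 e - [:c:]) = e"
  unfolding diff_conv_add_uminus
  using assms by (subst degree_add_eq_left) (auto simp: degree_monom_eq)

lemma norm_root_radical:
  fixes z :: complex
  assumes "z ^ e = of_real (\<gamma> ^ e)" "\<gamma> > 0" "e > 0"
  shows "norm z = \<gamma>"
proof -
  have "norm z ^ e = \<gamma> ^ e"
    using assms by (simp flip: norm_power of_real_power)
  then show ?thesis
    using assms power_eq_iff_eq_base[of e "norm z" \<gamma>] by simp
qed

text \<open>The complex roots of a rational factor of \<open>x\<^sup>e - \<gamma>\<^sup>e\<close> all have modulus \<open>\<gamma>\<close>, so its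
  constant coefficient exhibits a rational power of \<open>\<gamma>\<close>.\<close>

lemma radical_factor_power_rat:
  fixes \<mu> :: "rat poly" and \<gamma> :: real
  assumes c: "\<gamma> ^ e = of_rat c" "\<gamma> > 0" "e > 0" and \<mu>: "\<mu> dvd monom 1 e - [:c:]"
  shows "\<gamma> ^ degree \<mu> \<in> \<rat>"
proof -
  let ?h = "of_rat :: rat \<Rightarrow> complex"
  let ?m = "map_poly ?h \<mu>"
  have f0: "monom 1 e - [:c:] \<noteq> 0"
  proof
    assume "monom 1 e - [:c:] = 0"
    then have "coeff (monom 1 e - [:c:]) e = 0" by simp
    then show False using c(3) by (simp add: coeff_pCons split: nat.splits)
  qed
  then have \<mu>0: "\<mu> \<noteq> 0" using \<mu> by auto
  obtain as where as: "Polynomial.smult (lead_coeff ?m) (\<Prod>a\<leftarrow>as. [:- a, 1:]) = ?m" "length as = degree ?m"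
    using fundamental_theorem_algebra_factorized[of ?m] by blast
  have norm_as: "norm a = \<gamma>" if "a \<in> set as" for a
  proof -
    have "poly (\<Prod>a\<leftarrow>as. [:- a, 1:]) a = 0"
      using that by (auto simp: poly_prod_list prod_list_zero_iff)
    then have "poly ?m a = 0" by (subst as(1)[symmetric]) simp
    moreover have "?m dvd map_poly ?h (monom 1 e - [:c:])"
      using \<mu> by (auto simp: dvd_def of_rat_poly_hom.hom_mult)
    ultimately have "poly (map_poly ?h (monom 1 e - [:c:])) a = 0" by (auto simp: dvd_def)
    then have "a ^ e = of_rat c"
      by (simp add: of_rat_poly_hom.hom_minus of_rat_hom.map_poly_hom_monom poly_monom of_rat_hom.map_poly_pCons_hom)
    then show ?thesis
      using c norm_root_radical[of a e \<gamma>] by (simp add: of_real_of_rat)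
  qed
  have "norm (poly (\<Prod>a\<leftarrow>xs. [:- a, 1:]) 0) = \<gamma> ^ length xs" if "set xs \<subseteq> set as" for xs
    using that by (induction xs) (auto simp: norm_mult norm_as)
  then have "norm (poly ?m 0) = norm (lead_coeff ?m) * \<gamma> ^ degree ?m"
    by (subst as(1)[symmetric]) (simp add: norm_mult as(2))
  then have "of_rat \<bar>coeff \<mu> 0\<bar> = of_rat \<bar>lead_coeff \<mu>\<bar> * \<gamma> ^ degree \<mu>"
    by (simp add: poly_0_coeff_0 flip: of_real_of_rat)
  then have "\<gamma> ^ degree \<mu> = of_rat (\<bar>coeff \<mu> 0\<bar> / \<bar>lead_coeff \<mu>\<bar>)"
    using \<mu>0 by (simp add: of_rat_divide field_simps)
  then show ?thesis by simp
qed

text \<open>The minimal polynomial \<mu> of \<gamma> divides the binomial of degree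
  \<open>e\<close>, and \<gamma> to the power \<open>degree \<mu>\<close> is rational. Minimality of
  \<open>e\<close> then forces \<open>degree \<mu> = e\<close>, so the binomial is associated to
  \<mu>.\<close>

lemma radical_minpoly_dvd:
  fixes p :: "rat poly"
  assumes c: "\<gamma> ^ e = of_rat c" "\<gamma> > 0" "e > 0"
    and minimal: "\<And>l. 0 < l \<Longrightarrow> l < e \<Longrightarrow> \<gamma> ^ l \<notin> \<rat>"
    and p: "rpoly p \<gamma> = 0"
  shows "monom 1 e - [:c:] dvd p"
proof -
  let ?f = "monom 1 e - [:c:]"
  have f: "rpoly ?f \<gamma> = 0"
    using c(1) by (simp add: of_rat_poly_hom.hom_minus of_rat_hom.map_poly_hom_monom poly_monom of_rat_hom.map_poly_pCons_hom)
  have degf: "degree ?f = e"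
    using c(3) by (simp add: degree_monom_minus_const)
  have f0: "?f \<noteq> 0" using degf c(3) by auto
  \<comment> \<open>A nonzero rational polynomial of least degree vanishing at \<gamma>;
    \<open>?f\<close> shows that one exists, and division with remainder shows that \<mu> divides
    all others.\<close>
  define \<mu> where "\<mu> = (ARG_MIN degree q. q \<noteq> 0 \<and> rpoly q \<gamma> = 0)"
  have \<mu>: "\<mu> \<noteq> 0" "rpoly \<mu> \<gamma> = 0"
    using arg_min_natI[of "\<lambda>q. q \<noteq> 0 \<and> rpoly q \<gamma> = 0" ?f degree] f f0
    unfolding \<mu>_def by auto
  have dvd: "\<mu> dvd q" if q: "rpoly q \<gamma> = 0" for q
  proof (rule ccontr)
    assume "\<not> \<mu> dvd q"
    then have r: "q mod \<mu> \<noteq> 0" by (simp add: dvd_eq_mod_eq_0)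
    have "rpoly q \<gamma> = rpoly (\<mu> * (q div \<mu>) + q mod \<mu>) \<gamma>" by simp
    then have "rpoly (q mod \<mu>) \<gamma> = 0"
      using q \<mu>(2) by (simp only: rpoly_simps)
    then have "degree \<mu> \<le> degree (q mod \<mu>)"
      using r arg_min_nat_le[of "\<lambda>q. q \<noteq> 0 \<and> rpoly q \<gamma> = 0" "q mod \<mu>" degree]
      unfolding \<mu>_def by simp
    then show False using degree_mod_less'[OF \<mu>(1) r] by simp
  qed
  have \<mu>f: "\<mu> dvd ?f" by (rule dvd[OF f])
  have "degree \<mu> > 0"
  proof (rule ccontr)
    assume "\<not> degree \<mu> > 0"
    then obtain a where "\<mu> = [:a:]" by (auto elim: degree_eq_zeroE)
    then show False using \<mu> by simp
  qed
  moreover have "\<gamma> ^ degree \<mu> \<in> \<rat>" by (rule radical_factor_power_rat[OF c \<mu>f])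
  ultimately have "degree \<mu> \<ge> e" using minimal[of "degree \<mu>"] by fastforce
  moreover obtain s where s: "?f = \<mu> * s" using \<mu>f by (auto simp: dvd_def)
  ultimately have "degree s = 0" using degf f0 \<mu>(1) by (auto simp: degree_mult_eq)
  then have "s dvd 1" using f0 s by (subst is_unit_iff_degree) auto
  then show ?thesis using dvd[OF p] unfolding s by (simp add: mult_unit_dvd_iff)
qed

text \<open>Strong induction on the degree: the binomial \<open>?f\<close> divides \<open>p\<close>,
  and the quotient inherits the hypotheses as long as it is not constant. Since \<open>?f\<close>
  has no term of degree \<open>e - 1\<close>, the second coefficient of \<open>p\<close> is that of
  the quotient. In effect \<open>p\<close> is a power of \<open>?f\<close>.\<close>

lemma coeff_eq_0_of_radical_factors:
  fixes p :: "rat poly"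
  assumes c: "\<gamma> ^ e = of_rat c" "\<gamma> > 0" "e \<ge> 2"
    and minimal: "\<And>l. 0 < l \<Longrightarrow> l < e \<Longrightarrow> \<gamma> ^ l \<notin> \<rat>"
    and p: "lead_coeff p = 1" "degree p > 0"
      "\<And>g. g dvd p \<Longrightarrow> degree g > 0 \<Longrightarrow> rpoly g \<gamma> = 0"
  shows "coeff p (degree p - 1) = 0"
  using p
proof (induction "degree p" arbitrary: p rule: less_induct)
  case less
  let ?f = "monom 1 e - [:c:]"
  have degf: "degree ?f = e"
    using c(3) by (simp add: degree_monom_minus_const)
  have lf: "lead_coeff ?f = 1" using c(3) by (simp add: degf coeff_pCons split: nat.split)
  have "?f dvd p"
    using less.prems c by (intro radical_minpoly_dvd[OF c(1,2) _ minimal]) auto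
  then obtain q where q: "p = ?f * q" by (auto simp: dvd_def)
  have lq: "lead_coeff q = 1" using less.prems(1) lf unfolding q lead_coeff_mult by simp
  have f0: "?f \<noteq> 0" using degf c(3) by (metis degree_0 not_numeral_le_zero)
  have q0: "q \<noteq> 0" using lq by auto
  have degp: "degree p = e + degree q"
    unfolding q using f0 q0 by (simp add: degree_mult_eq degf)
  have coeff: "coeff p (degree p - 1) = (if degree p - 1 < e then 0 else coeff q (degree p - 1 - e))
      - c * coeff q (degree p - 1)"
    unfolding q by (simp add: left_diff_distrib coeff_monom_mult)
  \<comment> \<open>Here \<open>e \<ge> 2\<close> enters: it puts \<open>degree p - 1\<close> above
    \<open>degree q\<close>, so the constant term of \<open>?f\<close> contributes nothing.\<close>
  have "coeff q (degree p - 1) = 0"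
    using degp c(3) by (intro coeff_eq_0) simp
  moreover have "coeff q (degree p - 1 - e) = 0" if "\<not> degree p - 1 < e"
  proof -
    have "degree q > 0" using that degp c(3) by simp
    moreover have "rpoly g \<gamma> = 0" if "g dvd q" "degree g > 0" for g
      using less.prems(3)[of g] that unfolding q by auto
    ultimately have "coeff q (degree q - 1) = 0"
      using less.hyps[of q] lq degp c(3) by auto
    then show ?thesis using degp by simp
  qed
  ultimately show ?case using coeff by simp
qed

text \<open>Every nonconstant rational factor of \<open>char_poly M\<close> vanishes at \<gamma>, so
  its second coefficient, which is minus the trace, is 0.\<close>

lemma mat_trace_irrational_radical:
  assumes w: "rat_indep N w" "left_eigen N w M \<gamma>" "N > 0"
    and \<gamma>: "\<gamma> > 0" "\<gamma> \<notin> \<rat>" "E > 0" "\<gamma> ^ E \<in> \<rat>"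
  shows "mat_trace M = 0"
proof -
  have M: "M \<in> carrier_mat N N" using w unfolding left_eigen_def by simp
  \<comment> \<open>The least positive exponent giving a rational power; it is at least 2 because
    \<gamma> itself is irrational.\<close>
  define e where "e = (LEAST l. l > 0 \<and> \<gamma> ^ l \<in> \<rat>)"
  have e: "e > 0" "\<gamma> ^ e \<in> \<rat>"
    using LeastI[of "\<lambda>l. l > 0 \<and> \<gamma> ^ l \<in> \<rat>" E] \<gamma> unfolding e_def by auto
  have minimal: "\<gamma> ^ l \<notin> \<rat>" if "0 < l" "l < e" for l
    using not_less_Least[of l "\<lambda>l. l > 0 \<and> \<gamma> ^ l \<in> \<rat>"] that unfolding e_def by blast
  have "e \<noteq> 1" using e \<gamma>(2) by auto
  then have e2: "e \<ge> 2" using e by simp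
  obtain c where c: "\<gamma> ^ e = of_rat c" using e(2) by (auto elim: Rats_cases)
  have deg: "degree (char_poly M) = N" "lead_coeff (char_poly M) = 1"
    using degree_monic_char_poly[OF M] by auto
  have "coeff (char_poly M) (degree (char_poly M) - 1) = 0"
    using deg w by (intro coeff_eq_0_of_radical_factors[OF c \<gamma>(1) e2 minimal]
        rpoly_factor_char_poly_eq_0[OF w(1,2)]) auto
  then show ?thesis
    using coeff_char_poly_mat_trace[of M "N - 1"] M w(3) deg by simp
qed

section \<open>Linear independence of radicals over the rationals\<close>

interpretation rat_real: vector_space "\<lambda>q x. of_rat q * x :: real"
  by unfold_locales (simp_all add: algebra_simps of_rat_add of_rat_mult)

lemma rat_indepD:
  assumes "rat_indep N w" "(\<Sum>i<N. w i * of_rat (c i)) = 0" "i < N"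
  shows "c i = 0"
  using assms unfolding rat_indep_def by blast

lemma rat_indepI:
  assumes "bij_betw w {..<N} B" "rat_real.independent B"
  shows "rat_indep N w"
  unfolding rat_indep_def
proof (intro allI impI)
  fix c i
  assume sum: "(\<Sum>i<N. w i * of_rat (c i)) = 0" and i: "i < N"
  let ?v = "inv_into {..<N} w"
  have inj: "inj_on w {..<N}" and B: "B = w ` {..<N}" using assms(1) by (auto simp: bij_betw_def)
  have "(\<Sum>b\<in>B. of_rat (c (?v b)) * b) = (\<Sum>i<N. of_rat (c (?v (w i))) * w i)"
    unfolding B by (rule sum.reindex[OF inj, unfolded o_def])
  also have "\<dots> = 0" using sum inj by (simp add: mult.commute)
  finally have "c (?v (w i)) = 0"
    using rat_real.independentD[OF assms(2), of B "\<lambda>b. c (?v b)" "w i"] i B by auto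
  then show "c i = 0" using inj i by simp
qed

lemma ex_rat_coords:
  fixes N :: nat
  assumes "bij_betw w {..<N} B" "v \<in> rat_real.span B"
  shows "\<exists>c. v = (\<Sum>i<N. w i * of_rat (c i))"
proof -
  have inj: "inj_on w {..<N}" and B: "B = w ` {..<N}" using assms(1) by (auto simp: bij_betw_def)
  then have "finite B" by simp
  then obtain u where "v = (\<Sum>b\<in>B. of_rat (u b) * b)"
    using assms(2) unfolding rat_real.span_finite[OF \<open>finite B\<close>] by auto
  also have "\<dots> = (\<Sum>i<N. w i * of_rat (u (w i)))"
    unfolding B by (subst sum.reindex[OF inj]) (simp add: mult.commute)
  finally show ?thesis by (intro exI[of _ "\<lambda>i. u (w i)"])
qed

lemma mult_span_subset:
  assumes "\<And>s. s \<in> S \<Longrightarrow> g * s \<in> rat_real.span S" "v \<in> rat_real.span S"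
  shows "g * v \<in> rat_real.span S"
  using assms(2)
proof (induction rule: rat_real.span_induct_alt)
  case base
  then show ?case by (simp add: rat_real.span_zero)
next
  case (step c x y)
  have "of_rat c * (g * x) + g * y \<in> rat_real.span S"
    using step assms(1) by (intro rat_real.span_add rat_real.span_scale) auto
  then show ?case by (simp add: algebra_simps)
qed

text \<open>The monomials in the \<open>g i\<close> with exponents below \<open>E\<close> span a finite-dimensional rational
  algebra; the matrices describe multiplication by the \<open>g i\<close> in a basis of it.\<close>

lemma ex_multiplication_matrices:
  fixes g :: "'i \<Rightarrow> real"
  assumes I: "finite I" and E: "E > 0" and g: "\<And>i. i \<in> I \<Longrightarrow> g i ^ E \<in> \<rat>"
  shows "\<exists>N w. N > 0 \<and> rat_indep N w \<and> (\<forall>i\<in>I. \<exists>M. left_eigen N w M (g i))"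
proof -
  define mon where "mon e = (\<Prod>i\<in>I. g i ^ e i)" for e :: "'i \<Rightarrow> nat"
  define S where "S = mon ` (I \<rightarrow>\<^sub>E {..<E})"
  have fin: "finite S" unfolding S_def using I by (auto intro: finite_PiE)
  have step: "g i * s \<in> rat_real.span S" if i: "i \<in> I" and s: "s \<in> S" for i s
  proof -
    obtain e where e: "e \<in> I \<rightarrow>\<^sub>E {..<E}" "s = mon e" using s unfolding S_def by blast
    have mon_upd: "mon (e(i := k)) = g i ^ k * (\<Prod>j\<in>I - {i}. g j ^ e j)" for k
      unfolding mon_def using I i by (subst prod.remove[of _ i]) (auto intro!: prod.cong)
    have "s = g i ^ e i * (\<Prod>j\<in>I - {i}. g j ^ e j)"
      using mon_upd[of "e i"] e by simp
    then have gs: "g i * s = g i ^ Suc (e i) * (\<Prod>j\<in>I - {i}. g j ^ e j)" by simp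
    show ?thesis
    proof (cases "Suc (e i) < E")
      case True
      have "e(i := Suc (e i)) \<in> I \<rightarrow>\<^sub>E {..<E}"
        using e i True by (auto simp: PiE_iff extensional_def)
      then have "g i * s \<in> S" unfolding S_def gs mon_upd[symmetric] by blast
      then show ?thesis by (rule rat_real.span_base)
    next
      case False
      \<comment> \<open>At exponent \<open>E\<close> the monomial wraps around:
        \<open>g i ^ E\<close> is rational, which leaves a rational multiple of the monomial with
        exponent 0 at \<open>i\<close>.\<close>
      have "e i < E" using e(1) i by (auto simp: PiE_iff)
      then have eq: "Suc (e i) = E" using False by simp
      obtain c where c: "g i ^ E = of_rat c" using g[OF i] by (auto elim: Rats_cases)
      have "e(i := 0) \<in> I \<rightarrow>\<^sub>E {..<E}"
        using e i E by (auto simp: PiE_iff extensional_def)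
      then have "mon (e(i := 0)) \<in> rat_real.span S"
        unfolding S_def by (intro rat_real.span_base) blast
      moreover have "g i * s = of_rat c * mon (e(i := 0))"
        unfolding gs eq c mon_upd by simp
      ultimately show ?thesis by (simp add: rat_real.span_scale)
    qed
  qed
  \<comment> \<open>That 1 lies in the span makes the basis \<open>B\<close> chosen below nonempty,
    so its size is positive.\<close>
  have one: "1 \<in> rat_real.span S"
  proof -
    have "(\<lambda>i\<in>I. 0) \<in> I \<rightarrow>\<^sub>E {..<E}" using E by auto
    then have "mon (\<lambda>i\<in>I. 0) \<in> rat_real.span S"
      unfolding S_def by (intro rat_real.span_base) blast
    then show ?thesis by (simp add: mon_def)
  qed
  obtain B where B: "B \<subseteq> S" "rat_real.independent B" "S \<subseteq> rat_real.span B"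
    using rat_real.maximal_independent_subset[of S] by blast
  have span: "rat_real.span S = rat_real.span B"
    using B rat_real.span_eq rat_real.span_superset by blast
  have finB: "finite B" using B(1) fin finite_subset by blast
  obtain w where w: "bij_betw w {..<card B} B"
    using ex_bij_betw_nat_finite[OF finB] by (auto simp: atLeast0LessThan)
  have "B \<noteq> {}"
    using one unfolding span by auto
  then have "card B > 0" using finB by (simp add: card_gt_0_iff)
  moreover have "\<exists>M. left_eigen (card B) w M (g i)" if i: "i \<in> I" for i
  proof -
    have "\<exists>c. g i * w j = (\<Sum>l<card B. w l * of_rat (c l))" if "j < card B" for j
    proof (rule ex_rat_coords[OF w])
      have "w j \<in> rat_real.span S"
        using w that B(1) by (auto simp: bij_betw_def intro: rat_real.span_base)
      then show "g i * w j \<in> rat_real.span B"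
        using mult_span_subset[of S "g i"] step[OF i] span by simp
    qed
    then obtain c where c: "\<And>j. j < card B \<Longrightarrow> g i * w j = (\<Sum>l<card B. w l * of_rat (c j l))"
      by metis
    have "left_eigen (card B) w (mat (card B) (card B) (\<lambda>(l, j). c j l)) (g i)"
      unfolding left_eigen_def by (simp add: c)
    then show ?thesis by blast
  qed
  ultimately show ?thesis using rat_indepI[OF w B(2)] by blast
qed

text \<open>By independence of \<open>w\<close>, a rational relation between the multipliers
  \<open>g i\<close> holds between their matrices entry by entry, hence between the traces. The
  trace thus acts as a linear form on the multipliers.\<close>

lemma mat_trace_left_eigen_combination:
  assumes w: "rat_indep N w" and M: "\<And>i. i \<in> I \<Longrightarrow> left_eigen N w (M i) (g i)"
    and sum: "(\<Sum>i\<in>I. of_rat (c i) * g i) = 0"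
  shows "(\<Sum>i\<in>I. c i * mat_trace (M i)) = 0"
proof -
  have entry: "(\<Sum>i\<in>I. c i * M i $$ (l, j)) = 0" if "l < N" "j < N" for l j
  proof -
    have "(\<Sum>l<N. w l * of_rat (\<Sum>i\<in>I. c i * M i $$ (l, j)))
        = (\<Sum>l<N. \<Sum>i\<in>I. of_rat (c i) * (w l * of_rat (M i $$ (l, j))))"
      by (simp add: of_rat_sum of_rat_mult sum_distrib_left mult_ac)
    also have "\<dots> = (\<Sum>i\<in>I. of_rat (c i) * (\<Sum>l<N. w l * of_rat (M i $$ (l, j))))"
      by (subst sum.swap) (simp add: sum_distrib_left)
    also have "\<dots> = (\<Sum>i\<in>I. of_rat (c i) * (g i * w j))"
      using M that(2) unfolding left_eigen_def by simp
    also have "\<dots> = (\<Sum>i\<in>I. of_rat (c i) * g i) * w j"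
      by (simp add: sum_distrib_right mult.assoc)
    finally have "(\<Sum>l<N. w l * of_rat (\<Sum>i\<in>I. c i * M i $$ (l, j))) = 0" using sum by simp
    then show ?thesis using rat_indepD[OF w, of "\<lambda>l. \<Sum>i\<in>I. c i * M i $$ (l, j)"] that(1) by blast
  qed
  have "(\<Sum>i\<in>I. c i * mat_trace (M i)) = (\<Sum>i\<in>I. \<Sum>l<N. c i * M i $$ (l, l))"
    using M unfolding left_eigen_def
    by (intro sum.cong) (auto simp: mat_trace_def sum_distrib_left)
  also have "\<dots> = (\<Sum>l<N. \<Sum>i\<in>I. c i * M i $$ (l, l))" by (rule sum.swap)
  finally show ?thesis using entry by simp
qed

text \<open>The coordinates of each \<open>w l\<close> with respect to \<open>w\<close> are unique,
  so the diagonal entries of \<open>M\<close> are those of the identity.\<close>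

lemma mat_trace_left_eigen_one:
  assumes "rat_indep N w" "left_eigen N w M 1"
  shows "mat_trace M = of_nat N"
proof -
  have "M $$ (l, l) = 1" if l: "l < N" for l
  proof -
    have "(\<Sum>i<N. w i * of_rat (M $$ (i, l) - (if i = l then 1 else 0)))
        = (\<Sum>i<N. w i * of_rat (M $$ (i, l))) - (\<Sum>i<N. if i = l then w i else 0)"
      unfolding sum_subtractf[symmetric] by (intro sum.cong) (auto simp: of_rat_diff algebra_simps)
    also have "\<dots> = 0" using assms(2) l unfolding left_eigen_def by simp
    finally show ?thesis
      using rat_indepD[OF assms(1), of "\<lambda>i. M $$ (i, l) - (if i = l then 1 else 0)" l] l by simp
  qed
  then show ?thesis using assms(2) unfolding left_eigen_def mat_trace_def by auto
qed

text \<open>The trace from the algebra generated by the ratios \<open>b i / b k\<close> kills every ratio except the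
  one with \<open>i = k\<close>, so applying it to a rational relation isolates the coefficient of \<open>b k\<close>.\<close>

theorem radicals_rat_independent:
  fixes b :: "'i \<Rightarrow> real"
  assumes I: "finite I" and pos: "\<And>i. i \<in> I \<Longrightarrow> b i > 0"
    and E: "E > 0" "\<And>i. i \<in> I \<Longrightarrow> b i ^ E \<in> \<rat>"
    and irr: "\<And>i j. i \<in> I \<Longrightarrow> j \<in> I \<Longrightarrow> i \<noteq> j \<Longrightarrow> b i / b j \<notin> \<rat>"
    and sum: "(\<Sum>i\<in>I. of_rat (c i) * b i) = 0" and k: "k \<in> I"
  shows "c k = 0"
proof -
  define g where "g i = b i / b k" for i
  have "g i ^ E \<in> \<rat>" if "i \<in> I" for i
    using E(2)[OF that] E(2)[OF k] by (simp add: g_def power_divide)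
  then obtain N w where w: "N > 0" "rat_indep N w" "\<forall>i\<in>I. \<exists>M. left_eigen N w M (g i)"
    using ex_multiplication_matrices[OF I E(1), of g] by blast
  then obtain M where M: "\<And>i. i \<in> I \<Longrightarrow> left_eigen N w (M i) (g i)" by metis
  have tr0: "mat_trace (M i) = 0" if "i \<in> I" "i \<noteq> k" for i
    using that w pos irr[OF that(1) k] E k M[OF that(1)]
    by (intro mat_trace_irrational_radical[OF w(2) _ w(1), of _ "g i" E])
      (auto simp: g_def power_divide)
  have "g k = 1" using pos[OF k] by (simp add: g_def)
  then have trk: "mat_trace (M k) = of_nat N"
    using M[OF k] mat_trace_left_eigen_one[OF w(2)] by simp
  have "(\<Sum>i\<in>I. of_rat (c i) * g i) = (\<Sum>i\<in>I. of_rat (c i) * b i) / b k"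
    by (simp add: g_def sum_divide_distrib)
  then have "(\<Sum>i\<in>I. c i * mat_trace (M i)) = 0"
    using sum by (intro mat_trace_left_eigen_combination[OF w(2) M]) auto
  also have "(\<Sum>i\<in>I. c i * mat_trace (M i)) = c k * of_nat N"
    using I k tr0 trk by (subst sum.remove[of _ k]) auto
  finally show ?thesis using w(1) by simp
qed

section \<open>Right and left eigenvectors of binomial companion matrices\<close>

lemma binomial_companion_carrier [simp]: "binomial_companion n a \<in> carrier_mat n n"
  by (simp add: binomial_companion_def)

lemma binomial_companion_eigenvalue:
  fixes a z :: "'a::field"
  assumes "n > 0" "z ^ n = a"
  shows "eigenvalue (binomial_companion n a) z"
proof -
  let ?v = "vec n (\<lambda>i. z ^ (n - 1 - i))"
  have "(binomial_companion n a *\<^sub>v ?v) $ i = (z \<cdot>\<^sub>v ?v) $ i" if i: "i < n" for i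
  proof -
    have "(binomial_companion n a *\<^sub>v ?v) $ i
        = (\<Sum>j<n. (if i = Suc j then 1 else if i = 0 \<and> j = n - 1 then a else 0) * z ^ (n - 1 - j))"
      using i by (simp add: binomial_companion_def scalar_prod_def atLeast0LessThan)
    also have "\<dots> = z * z ^ (n - 1 - i)"
    proof (cases i)
      case 0
      have "(\<Sum>j<n. (if i = Suc j then 1 else if i = 0 \<and> j = n - 1 then a else 0) * z ^ (n - 1 - j))
          = (\<Sum>j<n. if j = n - 1 then a else 0)"
        using 0 by (intro sum.cong) auto
      also have "\<dots> = z * z ^ (n - 1)"
        using assms by (cases n) auto
      finally show ?thesis using 0 by simp
    next
      case (Suc i')
      have "(\<Sum>j<n. (if i = Suc j then 1 else if i = 0 \<and> j = n - 1 then a else 0) * z ^ (n - 1 - j))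
          = (\<Sum>j<n. if j = i' then z ^ (n - 1 - i') else 0)"
        using Suc by (intro sum.cong) auto
      also have "\<dots> = z ^ Suc (n - 1 - i)"
        using Suc i by (simp add: Suc_diff_Suc)
      finally show ?thesis by simp
    qed
    finally show ?thesis using i by simp
  qed
  then have "binomial_companion n a *\<^sub>v ?v = z \<cdot>\<^sub>v ?v"
    by (intro eq_vecI) (auto simp: binomial_companion_def)
  \<comment> \<open>The last entry is \<open>z ^ 0 = 1\<close>, so the vector is nonzero even for
    \<open>z = 0\<close>.\<close>
  moreover have "?v $ (n - 1) \<noteq> 0\<^sub>v n $ (n - 1)" using assms(1) by simp
  then have "?v \<noteq> 0\<^sub>v n" by metis
  ultimately show ?thesis
    unfolding eigenvalue_def eigenvector_def
    by (intro exI[of _ ?v]) (simp add: binomial_companion_def)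
qed

lemma Re_less_of_norm_eq:
  fixes z :: complex
  assumes "norm z = r" "z \<noteq> of_real r"
  shows "Re z < r"
proof (rule ccontr)
  assume "\<not> Re z < r"
  then have "Re z = r" using assms(1) complex_Re_le_cmod[of z] by simp
  moreover have "Im z = 0" using assms(1) \<open>Re z = r\<close> cmod_power2[of z] by simp
  ultimately show False using assms(2) by (simp add: complex_eq_iff)
qed

text \<open>The \<open>n\<close> distinct complex roots of \<open>z ^ n = r ^ n\<close> are
  eigenvalues, so by counting they are the whole spectrum, each occurring once. All have modulus
  \<open>r\<close>, and on that circle only \<open>r\<close> has real part \<open>r\<close>.\<close>

lemma simple_dominant_binomial_companion:
  assumes n: "n > 0" and r: "r > 0"
  shows "simple_dominant (binomial_companion n (of_real (r ^ n))) r"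
proof -
  let ?A = "binomial_companion n (of_real (r ^ n)) :: complex mat"
  have A: "?A \<in> carrier_mat n n" by simp
  obtain as where as: "char_poly ?A = (\<Prod>a\<leftarrow>as. [:- a, 1:])" "length as = n"
    using char_poly_factorized[OF A] by blast
  have sub: "{z. z ^ n = of_real (r ^ n)} \<subseteq> set as"
  proof
    fix z :: complex assume "z \<in> {z. z ^ n = of_real (r ^ n)}"
    then have "poly (char_poly ?A) z = 0"
      using binomial_companion_eigenvalue[OF n] eigenvalue_root_char_poly[OF A] by blast
    then show "z \<in> set as" unfolding as(1) by (auto simp: poly_prod_list prod_list_zero_iff)
  qed
  have card: "card {z :: complex. z ^ n = of_real (r ^ n)} = n"
    using n r by (intro card_nth_roots) auto
  have "card (set as) \<le> n" using as(2) card_length by metis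
  then have set_as: "set as = {z. z ^ n = of_real (r ^ n)}"
    using card_subset_eq[OF finite_set sub] card card_mono[OF finite_set sub] by simp
  then have dist: "distinct as" using card as(2) by (simp add: card_distinct)
  have "of_real r \<in> set as" unfolding set_as by simp
  then obtain k where k: "k < n" "as ! k = of_real r" using as(2) by (auto simp: in_set_conv_nth)
  have less: "Re (as ! i) < r" if i: "i < n" "i \<noteq> k" for i
  proof (rule Re_less_of_norm_eq)
    have "as ! i \<in> set as" using i as(2) by simp
    then have "(as ! i) ^ n = of_real (r ^ n)" unfolding set_as by simp
    then show "norm (as ! i) = r" using r n by (rule norm_root_radical)
    show "as ! i \<noteq> of_real r"
      using dist i k as(2) nth_eq_iff_index_eq by metis
  qed
  \<comment> \<open>The Schur form carries the eigenvalues on its diagonal in the order of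
    \<open>as\<close>, so the position \<open>k\<close> of \<open>r\<close> in the list is also its
    diagonal position.\<close>
  obtain T P Q where T: "schur_decomposition ?A as = (T, P, Q)"
    by (cases "schur_decomposition ?A as")
  have wit: "similar_mat_wit ?A T P Q" and ut: "upper_triangular T" and diag: "diag_mat T = as"
    using schur_decomposition[OF A as(1) T] by auto
  have Tc: "T \<in> carrier_mat n n" by (rule similar_mat_witD2(5)[OF A wit])
  then have "T $$ (i, i) = as ! i" if "i < n" for i
    using that unfolding diag[symmetric] diag_mat_def by simp
  then show ?thesis
    unfolding simple_dominant_def using A Tc wit ut k less
    by (intro exI[of _ n] exI[of _ T] exI[of _ k]) (auto simp: similar_mat_def)
qed

text \<open>Multiplication by \<open>r\<close> shifts the powers \<open>r ^ j\<close>; the last one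
  wraps around to \<open>r ^ n = a\<close>, which is the top-right entry.\<close>

lemma left_eigen_binomial_companion:
  assumes "n > 0" "r ^ n = of_rat a"
  shows "left_eigen n (\<lambda>i. r ^ i) (binomial_companion n a) r"
proof -
  have "(\<Sum>i<n. r ^ i * of_rat (binomial_companion n a $$ (i, j))) = r * r ^ j" if j: "j < n" for j
  proof (cases "Suc j = n")
    case True
    have "(\<Sum>i<n. r ^ i * of_rat (binomial_companion n a $$ (i, j)))
        = (\<Sum>i<n. if i = 0 then of_rat a else 0)"
      using j True by (intro sum.cong) (auto simp: binomial_companion_def)
    then show ?thesis using assms True[symmetric] by simp
  next
    case False
    have "(\<Sum>i<n. r ^ i * of_rat (binomial_companion n a $$ (i, j)))
        = (\<Sum>i<n. if i = Suc j then r ^ Suc j else 0)"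
      using j False by (intro sum.cong) (auto simp: binomial_companion_def)
    then show ?thesis using False j by simp
  qed
  then show ?thesis unfolding left_eigen_def by simp
qed

text \<open>The eigenvector is the tensor product of \<open>u\<close> and \<open>v\<close>: one
  summand of the Kronecker sum multiplies its first factor by \<beta>, the other its second factor
  by \<gamma>.\<close>

lemma left_eigen_kronecker_sum:
  assumes u: "left_eigen p u A \<beta>" and v: "left_eigen q v B \<gamma>"
  shows "left_eigen (p * q) (\<lambda>i. u (i div q) * v (i mod q)) (kronecker_sum A B) (\<beta> + \<gamma>)"
proof -
  have A: "A \<in> carrier_mat p p" and B: "B \<in> carrier_mat q q"
    using u v unfolding left_eigen_def by auto
  have "(\<Sum>i<p * q. u (i div q) * v (i mod q) * of_rat (kronecker_sum A B $$ (i, j)))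
      = (\<beta> + \<gamma>) * (u (j div q) * v (j mod q))" if j: "j < p * q" for j
  proof -
    let ?a = "j div q" and ?b = "j mod q"
    have ab: "?a < p" "?b < q" using div_mod_less[OF j] by auto
    have "(\<Sum>i<p * q. u (i div q) * v (i mod q) * of_rat (kronecker_sum A B $$ (i, j)))
        = (\<Sum>i<p * q. u (i div q) * v (i mod q) *
            (of_rat (A $$ (i div q, ?a)) * (if i mod q = ?b then 1 else 0)
             + (if i div q = ?a then 1 else 0) * of_rat (B $$ (i mod q, ?b))))"
      using j by (intro sum.cong)
        (auto simp: kronecker_sum_index[OF A B] of_rat_add of_rat_mult)
    also have "\<dots> = (\<Sum>a<p. \<Sum>b<q. u a * v b *
            (of_rat (A $$ (a, ?a)) * (if b = ?b then 1 else 0)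
             + (if a = ?a then 1 else 0) * of_rat (B $$ (b, ?b))))"
      by (rule sum_div_mod)
    also have "\<dots> = (\<Sum>a<p. u a * of_rat (A $$ (a, ?a))) * (\<Sum>b<q. if b = ?b then v b else 0)
        + (\<Sum>a<p. if a = ?a then u a else 0) * (\<Sum>b<q. v b * of_rat (B $$ (b, ?b)))"
      unfolding sum_product sum.distrib[symmetric]
      by (intro sum.cong) (auto simp: algebra_simps)
    also have "\<dots> = (\<beta> * u ?a) * v ?b + u ?a * (\<gamma> * v ?b)"
      using u v ab unfolding left_eigen_def by simp
    finally show ?thesis by (simp add: algebra_simps)
  qed
  then show ?thesis
    using kronecker_sum_carrier[OF A B] unfolding left_eigen_def by simp
qed

section \<open>Iterated Kronecker sums of companion matrices\<close>

lemma kronecker_sum_list_Cons: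
  "As \<noteq> [] \<Longrightarrow> kronecker_sum_list (A # As) = kronecker_sum A (kronecker_sum_list As)"
  by (cases As) auto

context comm_ring_hom
begin

lemma map_mat_binomial_companion:
  "map_mat hom (binomial_companion n a) = binomial_companion n (hom a)"
  by (rule eq_matI) (auto simp: binomial_companion_def)

lemma map_mat_kronecker_sum:
  assumes A: "A \<in> carrier_mat p p" and B: "B \<in> carrier_mat q q"
  shows "map_mat hom (kronecker_sum A B) = kronecker_sum (map_mat hom A) (map_mat hom B)"
proof -
  have A': "map_mat hom A \<in> carrier_mat p p" and B': "map_mat hom B \<in> carrier_mat q q"
    using A B by auto
  note c = kronecker_sum_carrier[OF A B] kronecker_sum_carrier[OF A' B']
  show ?thesis
  proof (rule eq_matI)
    fix i j
    assume "i < dim_row (kronecker_sum (map_mat hom A) (map_mat hom B))"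
      and "j < dim_col (kronecker_sum (map_mat hom A) (map_mat hom B))"
    then have ij: "i < p * q" "j < p * q" using c by auto
    then show "map_mat hom (kronecker_sum A B) $$ (i, j)
        = kronecker_sum (map_mat hom A) (map_mat hom B) $$ (i, j)"
      using c(1) A B div_mod_less[OF ij(1)] div_mod_less[OF ij(2)]
      by (simp add: kronecker_sum_index[OF A B] kronecker_sum_index[OF A' B'] hom_add hom_mult)
  qed (use c in auto)
qed

end

text \<open>One induction builds both eigenvalue descriptions of the iterated sum: the left
  eigenvector of monomials over the rationals and the dominant eigenvalue over the complex numbers.
  The function \<open>e i\<close> is the exponent vector of the \<open>i\<close>-th monomial, given
  by the mixed-radix digits of \<open>i\<close>. It is 0 off \<open>js\<close>, so that equality of
  exponents on \<open>js\<close> is equality of functions.\<close>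

lemma kronecker_sum_list_companions:
  fixes a n :: "nat \<Rightarrow> nat" and r :: "nat \<Rightarrow> real"
  defines "K \<equiv> \<lambda>js. kronecker_sum_list (map (\<lambda>j. binomial_companion (n j) (of_nat (a j) :: rat)) js)"
  assumes "js \<noteq> []" "distinct js"
    and "\<And>j. j \<in> set js \<Longrightarrow> n j > 0 \<and> r j > 0 \<and> r j ^ n j = real (a j)"
  shows "\<exists>N e. N > 0 \<and> inj_on e {..<N} \<and>
      (\<forall>i<N. \<forall>j. if j \<in> set js then e i j < n j else e i j = 0) \<and>
      left_eigen N (\<lambda>i. \<Prod>j\<in>set js. r j ^ e i j) (K js) (\<Sum>j\<in>set js. r j) \<and>
      simple_dominant (map_mat of_rat (K js)) (\<Sum>j\<in>set js. r j)"
  using assms(2-)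
proof (induction js rule: list_nonempty_induct)
  case (single x)
  then have x: "n x > 0" "r x > 0" "r x ^ n x = real (a x)" by auto
  have "simple_dominant (map_mat of_rat (K [x])) (r x)"
    using simple_dominant_binomial_companion[OF x(1,2)] x(3)
    by (simp add: K_def of_rat_hom.map_mat_binomial_companion)
  moreover have "left_eigen (n x) (\<lambda>i. r x ^ i) (K [x]) (r x)"
    using left_eigen_binomial_companion[OF x(1), of "r x" "of_nat (a x)"] x(3) by (simp add: K_def)
  moreover have "inj_on (\<lambda>i j. if j = x then i else (0::nat)) {..<n x}"
    by (rule inj_onI) (metis (mono_tags))
  ultimately show ?case
    using x(1) by (intro exI[of _ "n x"] exI[of _ "\<lambda>i j. if j = x then i else 0"]) auto
next
  case (cons x xs)
  then have x: "n x > 0" "r x > 0" "r x ^ n x = real (a x)" "x \<notin> set xs" by auto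
  obtain N e where IH: "N > 0" "inj_on e {..<N}"
    "\<And>i j. i < N \<Longrightarrow> if j \<in> set xs then e i j < n j else e i j = 0"
    "left_eigen N (\<lambda>i. \<Prod>j\<in>set xs. r j ^ e i j) (K xs) (\<Sum>j\<in>set xs. r j)"
    "simple_dominant (map_mat of_rat (K xs)) (\<Sum>j\<in>set xs. r j)"
    using cons.IH cons.prems by fastforce
  let ?C = "binomial_companion (n x) (of_nat (a x) :: rat)"
  have K: "K (x # xs) = kronecker_sum ?C (K xs)"
    using cons.hyps by (simp add: K_def kronecker_sum_list_Cons)
  have Kc: "K xs \<in> carrier_mat N N" using IH(4) unfolding left_eigen_def by simp
  \<comment> \<open>The quotient by \<open>N\<close> is the new digit, the exponent of
    \<open>r x\<close>; the remainder gives the old ones.\<close>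
  define e' where "e' i = (e (i mod N))(x := i div N)" for i
  have dm: "i div N < n x" "i mod N < N" if "i < n x * N" for i
    using div_mod_less[OF that] by auto
  have "inj_on e' {..<n x * N}"
  proof (rule inj_onI)
    fix i i' assume i: "i \<in> {..<n x * N}" "i' \<in> {..<n x * N}" "e' i = e' i'"
    have div: "i div N = i' div N" using fun_cong[OF i(3), of x] by (simp add: e'_def)
    \<comment> \<open>The update in \<open>e'\<close> hides the value of \<open>e\<close> at
      \<open>x\<close>, but that value is 0 because \<open>x\<close> is not in
      \<open>xs\<close>.\<close>
    have "e (i mod N) j = e (i' mod N) j" for j
    proof (cases "j = x")
      case True
      then show ?thesis using IH(3)[of _ x] x(4) dm i by auto
    next
      case False
      then show ?thesis using fun_cong[OF i(3), of j] by (simp add: e'_def)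
    qed
    then have "i mod N = i' mod N" using inj_onD[OF IH(2)] dm i by (simp add: fun_eq_iff)
    then show "i = i'" using div by (metis div_mult_mod_eq)
  qed
  moreover have "if j \<in> set (x # xs) then e' i j < n j else e' i j = 0" if "i < n x * N" for i j
    using IH(3)[of "i mod N" j] dm[OF that] by (auto simp: e'_def)
  moreover have "left_eigen (n x * N) (\<lambda>i. \<Prod>j\<in>set (x # xs). r j ^ e' i j) (K (x # xs))
      (\<Sum>j\<in>set (x # xs). r j)"
  proof -
    have "(\<Prod>j\<in>set xs. r j ^ e' i j) = (\<Prod>j\<in>set xs. r j ^ e (i mod N) j)" for i
      using x(4) by (intro prod.cong) (auto simp: e'_def)
    then have "(\<Prod>j\<in>set (x # xs). r j ^ e' i j)
        = r x ^ (i div N) * (\<Prod>j\<in>set xs. r j ^ e (i mod N) j)" for i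
      using x(4) by (simp add: e'_def)
    then show ?thesis
      using left_eigen_kronecker_sum[OF left_eigen_binomial_companion[OF x(1)] IH(4)] x
      unfolding K by simp
  qed
  moreover have "simple_dominant (map_mat of_rat (K (x # xs))) (\<Sum>j\<in>set (x # xs). r j)"
    using simple_dominant_kronecker_sum[OF simple_dominant_binomial_companion[OF x(1,2)] IH(5)] x
    unfolding K
    by (simp add: of_rat_hom.map_mat_kronecker_sum[OF binomial_companion_carrier Kc]
        of_rat_hom.map_mat_binomial_companion)
  ultimately show ?case using x(1) IH(1)
    by (intro exI[of _ "n x * N"] exI[of _ e']) auto
qed

section \<open>Ratios of monomials in roots of coprime integers\<close>

text \<open>A power of the rational ratio is an equation between integers. At a prime dividing
  \<open>x j\<close>, coprimality removes all other radicands, so valuations show that a power of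
  \<open>x j\<close> is a perfect \<open>K\<close>-th power; its root is \<open>b\<close>. The
  minimality of the \<open>n j\<close> excludes such a \<open>b\<close> when the exponents stay
  below \<open>n j\<close>.\<close>

lemma radical_monomial_ratio_irrational:
  fixes n k x :: "'j \<Rightarrow> nat"
  defines "r \<equiv> \<lambda>j. root (k j) (real (x j))"
  assumes J: "finite J" and k: "\<And>j. j \<in> J \<Longrightarrow> k j > 0" and x: "\<And>j. j \<in> J \<Longrightarrow> x j > 0"
    and cop: "\<And>i j. i \<in> J \<Longrightarrow> j \<in> J \<Longrightarrow> i \<noteq> j \<Longrightarrow> coprime (x i) (x j)"
    and ratio: "(\<Prod>j\<in>J. r j ^ e j) / (\<Prod>j\<in>J. r j ^ f j) \<in> \<rat>"
    and j: "j \<in> J" "f j < e j"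
  shows "\<exists>b::nat. b > 0 \<and> real b = r j ^ (e j - f j)"
proof -
  have rpos: "r i > 0" if "i \<in> J" for i using k[OF that] x[OF that] by (simp add: r_def)
  \<comment> \<open>\<open>K\<close> is a common multiple of the root degrees and \<open>h i\<close>
    is the cofactor of \<open>k i\<close> in it, so \<open>r i ^ K\<close> is the integer
    \<open>x i ^ h i\<close>.\<close>
  define K where "K = (\<Prod>j\<in>J. k j)"
  define h where "h i = (\<Prod>l\<in>J - {i}. k l)" for i
  have K: "K = k i * h i" if "i \<in> J" for i
    unfolding K_def h_def using J that by (rule prod.remove)
  have K0: "K > 0" unfolding K_def using k by (intro prod_pos) auto
  have rK: "(r i ^ m) ^ K = real (x i ^ (h i * m))" if "i \<in> J" for i m
  proof -
    have "(r i ^ m) ^ K = (r i ^ k i) ^ (h i * m)"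
      unfolding K[OF that] by (simp add: mult_ac flip: power_mult)
    then show ?thesis using k[OF that] by (simp add: r_def)
  qed
  have mon: "(\<Prod>i\<in>J. r i ^ g i) ^ K = real (\<Prod>i\<in>J. x i ^ (h i * g i))" for g
    unfolding prod_power_distrib of_nat_prod by (rule prod.cong[OF refl]) (rule rK)
  obtain u v :: nat where uv: "v > 0" "(\<Prod>j\<in>J. r j ^ e j) / (\<Prod>j\<in>J. r j ^ f j) = real u / real v"
  proof -
    have pos: "(\<Prod>j\<in>J. r j ^ e j) / (\<Prod>j\<in>J. r j ^ f j) > 0"
      using rpos by (intro divide_pos_pos prod_pos zero_less_power)
    obtain u v :: nat where "v \<noteq> 0"
      "\<bar>(\<Prod>j\<in>J. r j ^ e j) / (\<Prod>j\<in>J. r j ^ f j)\<bar> = real u / real v"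
      using Rats_abs_nat_div_natE[OF ratio] by metis
    then show ?thesis using that[of v u] abs_of_pos[OF pos] by linarith
  qed
  have fpos: "(\<Prod>j\<in>J. r j ^ f j) > 0" and epos: "(\<Prod>j\<in>J. r j ^ e j) > 0"
    using rpos by (auto intro!: prod_pos)
  have upos: "u > 0"
    using uv fpos epos by (cases "u = 0") auto
  have "(\<Prod>j\<in>J. r j ^ e j) * real v = (\<Prod>j\<in>J. r j ^ f j) * real u"
    using uv fpos by (simp add: field_simps)
  then have "((\<Prod>j\<in>J. r j ^ e j) * real v) ^ K = ((\<Prod>j\<in>J. r j ^ f j) * real u) ^ K" by simp
  then have "real ((\<Prod>i\<in>J. x i ^ (h i * e i)) * v ^ K) = real ((\<Prod>i\<in>J. x i ^ (h i * f i)) * u ^ K)"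
    by (simp only: power_mult_distrib mon of_nat_mult of_nat_power)
  then have eq: "(\<Prod>i\<in>J. x i ^ (h i * e i)) * v ^ K = (\<Prod>i\<in>J. x i ^ (h i * f i)) * u ^ K"
    by (simp only: of_nat_eq_iff)
  \<comment> \<open>The factors with index other than \<open>j\<close>; they are coprime to
    \<open>x j\<close>.\<close>
  define R where "R g = (\<Prod>i\<in>J - {j}. x i ^ (h i * g i))" for g
  have split: "(\<Prod>i\<in>J. x i ^ (h i * g i)) = x j ^ (h j * g j) * R g" for g
    unfolding R_def using J j(1) by (rule prod.remove)
  have Rpos: "R g > 0" for g unfolding R_def using x by (intro prod_pos) auto
  have "h j * e j = h j * f j + h j * (e j - f j)"
    using j(2) by (simp flip: distrib_left)
  then have "x j ^ (h j * f j) * (x j ^ (h j * (e j - f j)) * R e * v ^ K)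
      = x j ^ (h j * f j) * (R f * u ^ K)"
    using eq unfolding split by (simp add: power_add mult_ac)
  then have eq': "x j ^ (h j * (e j - f j)) * R e * v ^ K = R f * u ^ K"
    using x[OF j(1)] by simp
  have "K dvd multiplicity p (x j ^ (h j * (e j - f j)))" if p: "prime p" for p
  proof (cases "p dvd x j")
    case False
    then have "\<not> p dvd x j ^ (h j * (e j - f j))" using p prime_dvd_power by blast
    then show ?thesis by (simp add: not_dvd_imp_multiplicity_0)
  next
    case True
    have nd: "multiplicity p (R g) = 0" for g
    proof (rule not_dvd_imp_multiplicity_0, rule notI)
      assume "p dvd R g"
      then obtain i where i: "i \<in> J - {j}" "p dvd x i ^ (h i * g i)"
        unfolding R_def using p J by (auto simp: prime_dvd_prod_iff)
      then have "p dvd x i" using p prime_dvd_power by blast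
      then have "p dvd 1"
        using coprime_common_divisor[OF cop[of i j]] i(1) j(1) True by auto
      then show False using p by auto
    qed
    have pe: "prime_elem p" using p by simp
    \<comment> \<open>At \<open>p\<close> only \<open>x j\<close>, \<open>u\<close> and
      \<open>v\<close> contribute, and the valuations of \<open>u ^ K\<close> and
      \<open>v ^ K\<close> are multiples of \<open>K\<close>.\<close>
    have "multiplicity p (x j ^ (h j * (e j - f j)) * R e * v ^ K) = multiplicity p (R f * u ^ K)"
      using eq' by simp
    then have "multiplicity p (x j ^ (h j * (e j - f j))) + K * multiplicity p v
        = K * multiplicity p u"
      using x[OF j(1)] Rpos[of e] Rpos[of f] uv(1) upos
      by (simp add: prime_elem_multiplicity_mult_distrib[OF pe]
          prime_elem_multiplicity_power_distrib[OF pe] nd del: power_mult)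
    then show ?thesis by (metis dvd_add_left_iff dvd_triv_left)
  qed
  then have "is_nth_power K (x j ^ (h j * (e j - f j)))"
    using is_nth_power_conv_multiplicity_nat[OF K0] by blast
  then obtain b where b: "x j ^ (h j * (e j - f j)) = b ^ K" by (elim is_nth_powerE)
  have "(r j ^ (e j - f j)) ^ K = real b ^ K"
    unfolding rK[OF j(1)] b by simp
  then have "r j ^ (e j - f j) = real b"
    using rpos[OF j(1)] K0 by (subst (asm) power_eq_iff_eq_base) auto
  moreover have "b > 0" using b x[OF j(1)] K0 by (cases "b = 0") (auto simp: zero_power)
  ultimately show ?thesis by metis
qed

section \<open>Irreducibility of the characteristic polynomial\<close>

theorem theorem7:
  fixes m :: nat and n k x a :: "nat \<Rightarrow> nat"
  assumes "m > 0"
    and "\<And>j. j \<in> {1..m} \<Longrightarrow> n j > 0"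
    and "\<And>j. j \<in> {1..m} \<Longrightarrow> k j > 0"
    and "\<And>j. j \<in> {1..m} \<Longrightarrow> x j > 0"
    and "\<And>i j. i \<in> {1..m} \<Longrightarrow> j \<in> {1..m} \<Longrightarrow> i \<noteq> j \<Longrightarrow> coprime (x i) (x j)"
    and "\<And>j. j \<in> {1..m} \<Longrightarrow> a j > 0 \<and> real (a j) = root (k j) (real (x j)) ^ n j"
    and "\<And>j l. j \<in> {1..m} \<Longrightarrow> 0 < l \<Longrightarrow> l < n j \<Longrightarrow>
           \<not> (\<exists>b::nat. b > 0 \<and> real b = root (k j) (real (x j)) ^ l)"
  shows "irreducible (q_poly m n (\<lambda>j. of_nat (a j)) :: rat poly)"
proof -
  let ?J = "{1..m}"
  define r where "r j = root (k j) (real (x j))" for j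
  have rpos: "r j > 0" if "j \<in> ?J" for j using assms(3,4)[OF that] by (simp add: r_def)
  have rn: "r j ^ n j = real (a j)" if "j \<in> ?J" for j using assms(6)[OF that] by (simp add: r_def)
  let ?M = "kronecker_sum_list
      (map (\<lambda>j. binomial_companion (n j) (of_nat (a j) :: rat)) [1..<Suc m])"
  have J: "set [1..<Suc m] = ?J" by auto
  obtain N e where N: "N > 0" "inj_on e {..<N}"
    and e: "\<And>i j. i < N \<Longrightarrow> if j \<in> ?J then e i j < n j else e i j = 0"
    and M: "left_eigen N (\<lambda>i. \<Prod>j\<in>?J. r j ^ e i j) ?M (\<Sum>j\<in>?J. r j)"
      "simple_dominant (map_mat of_rat ?M) (\<Sum>j\<in>?J. r j)"
    using kronecker_sum_list_companions[of "[1..<Suc m]" n r a] assms(1,2) rpos rn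
    unfolding J by (auto simp del: upt_Suc)
  define w where "w i = (\<Prod>j\<in>?J. r j ^ e i j)" for i
  have wpos: "w i > 0" for i unfolding w_def using rpos by (intro prod_pos) auto
  have irr: "w i / w i' \<notin> \<rat>" if i: "i < N" "i' < N" "i \<noteq> i'" for i i'
  proof
    assume rat: "w i / w i' \<in> \<rat>"
    \<comment> \<open>A larger exponent in the numerator would make \<open>r j\<close> to the
      difference a positive integer, with the difference positive and less than \<open>n j\<close>,
      against minimality.\<close>
    have le: "e l j \<le> e l' j" if l: "l < N" "w l / w l' \<in> \<rat>" and j: "j \<in> ?J" for l l' j
    proof (rule ccontr)
      assume "\<not> e l j \<le> e l' j"
      then have less: "e l' j < e l j" by simp
      have "\<exists>b::nat. b > 0 \<and> real b = root (k j) (real (x j)) ^ (e l j - e l' j)"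
        using l(2) assms(3-5) less j unfolding w_def r_def
        by (intro radical_monomial_ratio_irrational[of ?J k x "e l" "e l'" j]) auto
      moreover have "e l j - e l' j < n j" using e[OF l(1), of j] j by auto
      ultimately show False using assms(7)[OF j, of "e l j - e l' j"] less by auto
    qed
    have "inverse (w i / w i') \<in> \<rat>" using rat by (rule Rats_inverse)
    then have rat': "w i' / w i \<in> \<rat>" by (simp add: inverse_eq_divide)
    \<comment> \<open>Applied to the ratio and to its inverse, \<open>le\<close> gives equality on
      \<open>?J\<close>; elsewhere both exponents are 0.\<close>
    have "e i j = e i' j" for j
      using le[OF i(1) rat] le[OF i(2) rat'] e[OF i(1), of j] e[OF i(2), of j]
      by (cases "j \<in> ?J") (auto intro: antisym)
    then show False using inj_onD[OF N(2), of i i'] i by (simp add: fun_eq_iff)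
  qed
  have "rat_indep N w"
    unfolding rat_indep_def
  proof (intro allI impI)
    fix c l
    assume sum: "(\<Sum>i<N. w i * of_rat (c i)) = 0" and l: "l < N"
    \<comment> \<open>A common multiple of the \<open>n j\<close>, so that the \<open>E\<close>-th
      power of every monomial is rational.\<close>
    define E where "E = (\<Prod>j\<in>?J. n j)"
    have E0: "E > 0" unfolding E_def using assms(2) by (intro prod_pos) auto
    have E: "w i ^ E \<in> \<rat>" for i
    proof -
      have "(r j ^ e i j) ^ E \<in> \<rat>" if j: "j \<in> ?J" for j
      proof -
        have "n j dvd E" unfolding E_def using j by (intro dvd_prodI) auto
        then obtain t where "E = n j * t" by (auto simp: dvd_def)
        then have "(r j ^ e i j) ^ E = (r j ^ n j) ^ (t * e i j)"
          by (simp add: mult_ac flip: power_mult)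
        then show ?thesis using rn[OF j] by simp
      qed
      then show ?thesis unfolding w_def by (auto simp: prod_power_distrib intro: Rats_prod)
    qed
    show "c l = 0"
    proof (rule radicals_rat_independent[of "{..<N}" w E c l])
      show "(\<Sum>i<N. of_rat (c i) * w i) = 0" using sum by (simp only: mult.commute)
      show "w i / w i' \<notin> \<rat>" if "i \<in> {..<N}" "i' \<in> {..<N}" "i \<noteq> i'" for i i'
        using irr that by simp
      show "l \<in> {..<N}" using l by simp
    qed (rule finite_lessThan wpos E0 E)+
  qed
  moreover obtain h where "char_poly (map_mat of_rat ?M) = [:- complex_of_real (\<Sum>j\<in>?J. r j), 1:] * h"
    "poly h (of_real (\<Sum>j\<in>?J. r j)) \<noteq> 0"
    using simple_dominant_char_poly[OF M(2)] by blast
  ultimately show ?thesis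
    unfolding q_poly_def using irreducible_char_poly[OF _ M(1) N(1)] unfolding w_def by blast
qed

end
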